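(* There exist an $\mathcal{ALCH}$ ontology $\mathcal{O}$, an $\mathcal{ALC}$ concept $C_0$ and a signature $\Sigma$ such that, for every $n$, there is no $(\Sigma,n)$-uniform interpolant of $C_0$ under $\mathcal{O}$ of size smaller than $\mathrm{Tower}(n-2)$.
   Context: $\mathcal{ALC}$ concepts are built by $C,D ::= \top \mid A \mid \neg C \mid C\sqcap D \mid \exists r.C$ with $A$ a concept name and $r$ a role name (with the usual abbreviations $\forall r.C$, $\sqcup$, $\to$), interpreted in the standard way in interpretations $\mathcal{I}=(\Delta^{\mathcal{I}},\cdot^{\mathcal{I}})$. An $\mathcal{ALCH}$ ontology is a finite set of $\mathcal{ALC}$ concept inclusions $C\sqsubseteq D$ and role inclusions $r\sqsubseteq s$ ($r,s$ role names); $\mathcal{O}\models C\sqsubseteq D$ means $C^{\mathcal{I}}\subseteq D^{\mathcal{I}}$ in every model $\mathcal{I}$ of $\mathcal{O}$. A signature is a set $\Sigma$ of concept and role names; an $\mathcal{ALC}(\Sigma)$ concept is an $\mathcal{ALC}$ concept using only names from $\Sigma$. The role depth of a concept is the maximal nesting depth of existential (counting) restrictions; the size of a concept is the number of symbols needed to write it as a word. For $n\ge 0$, a $(\Sigma,n)$-uniform interpolant of $C_0$ under $\mathcal{O}$ is an $\mathcal{ALC}(\Sigma)$ concept $U$ such that $\mathcal{O}\models C_0\sqsubseteq U$ and $\mathcal{O}\models U\sqsubseteq E$ for every $\mathcal{ALC}(\Sigma)$ concept $E$ of role depth at most $n$ with $\mathcal{O}\models C_0\sqsubseteq E$. $\mathrm{Tower}(0)=1$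 and $\mathrm{Tower}(n+1)=2^{\mathrm{Tower}(n)}$. *)

theory Defs
  imports Main "HOL-Library.Countable_Set"
begin

type_synonym cname = nat
type_synonym rname = nat

datatype alc =
    Top
  | Name cname
  | Neg alc
  | Conj alc alc
  | Exists rname alc

datatype axm =
    ConceptIncl alc alc
  | RoleIncl rname rname

type_synonym signature = "(cname + rname) set"

record 'd interp =
  domain :: "'d set"
  cint :: "cname \<Rightarrow> 'd set"
  rint :: "rname \<Rightarrow> ('d \<times> 'd) set"

definition interpretation_wf :: "'d interp \<Rightarrow> bool" where
  "interpretation_wf I \<longleftrightarrow> domain I \<noteq> {} \<and> (\<forall>A. cint I A \<subseteq> domain I) \<and> (\<forall>r. rint I r \<subseteq> domain I \<times> domain I)"

primrec ext :: "'d interp \<Rightarrow> alc \<Rightarrow> 'd set" where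
  "ext I Top = domain I"
| "ext I (Name A) = cint I A"
| "ext I (Neg C) = domain I - ext I C"
| "ext I (Conj C D) = ext I C \<inter> ext I D"
| "ext I (Exists r C) = {x \<in> domain I. \<exists>y. (x, y) \<in> rint I r \<and> y \<in> ext I C}"

primrec satisfies :: "'d interp \<Rightarrow> axm \<Rightarrow> bool" where
  "satisfies I (ConceptIncl C D) \<longleftrightarrow> ext I C \<subseteq> ext I D"
| "satisfies I (RoleIncl r s) \<longleftrightarrow> rint I r \<subseteq> rint I s"

definition is_model :: "'d interp \<Rightarrow> axm set \<Rightarrow> bool" where
  "is_model I \<O> \<longleftrightarrow> interpretation_wf I \<and> (\<forall>a\<in>\<O>. satisfies I a)"

text \<open>HOL cannot quantify over the domain type inside a definition, so entailment ranges over the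
  interpretations whose domain is a nonempty (finite or infinite) set of natural numbers. By the
  downward Loewenheim-Skolem property, proved below as \<open>entails_all_models\<close>, this is the same as
  quantifying over models with elements of arbitrary type.\<close>

definition entails :: "axm set \<Rightarrow> alc \<Rightarrow> alc \<Rightarrow> bool" where
  "entails \<O> C D \<longleftrightarrow> (\<forall>I :: nat interp. is_model I \<O> \<longrightarrow> ext I C \<subseteq> ext I D)"

primrec sig :: "alc \<Rightarrow> signature" where
  "sig Top = {}"
| "sig (Name A) = {Inl A}"
| "sig (Neg C) = sig C"
| "sig (Conj C D) = sig C \<union> sig D"
| "sig (Exists r C) = insert (Inr r) (sig C)"

primrec role_depth :: "alc \<Rightarrow> nat" where
  "role_depth Top = 0"
| "role_depth (Name A) = 0"
| "role_depth (Neg C) = role_depth C"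
| "role_depth (Conj C D) = max (role_depth C) (role_depth D)"
| "role_depth (Exists r C) = Suc (role_depth C)"

text \<open>Word length in prefix notation, where no brackets or dots are needed and every concept or
  role name is one symbol. Any notation with additional punctuation gives larger sizes, so lower
  bounds for this size carry over.\<close>

primrec concept_size :: "alc \<Rightarrow> nat" where
  "concept_size Top = 1"
| "concept_size (Name A) = 1"
| "concept_size (Neg C) = 1 + concept_size C"
| "concept_size (Conj C D) = 1 + concept_size C + concept_size D"
| "concept_size (Exists r C) = 2 + concept_size C"

definition uniform_interpolant ::
    "signature \<Rightarrow> nat \<Rightarrow> axm set \<Rightarrow> alc \<Rightarrow> alc \<Rightarrow> bool" where
  "uniform_interpolant \<Sigma> n \<O> C\<^sub>0 U \<longleftrightarrow>
     sig U \<subseteq> \<Sigma> \<and> entails \<O> C\<^sub>0 U \<and>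
     (\<forall>E. sig E \<subseteq> \<Sigma> \<and> role_depth E \<le> n \<and> entails \<O> C\<^sub>0 E \<longrightarrow> entails \<O> U E)"

primrec Tower :: "nat \<Rightarrow> nat" where
  "Tower 0 = 1"
| "Tower (Suc n) = 2 ^ Tower n"

instance alc :: countable
  by countable_datatype

lemma ext_subset_domain: "interpretation_wf I \<Longrightarrow> ext I C \<subseteq> domain I"
  by (induction C) (auto simp: interpretation_wf_def)

primrec reach :: "'d interp \<Rightarrow> 'd \<Rightarrow> (rname \<times> alc) list \<Rightarrow> 'd" where
  "reach I x [] = x"
| "reach I x (p # l) =
     (if reach I x l \<in> ext I (Exists (fst p) (snd p))
      then SOME y. (reach I x l, y) \<in> rint I (fst p) \<and> y \<in> ext I (snd p)
      else reach I x l)"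

lemma reach_step:
  assumes "reach I x l \<in> ext I (Exists r C)"
  shows "(reach I x l, reach I x ((r, C) # l)) \<in> rint I r \<and> reach I x ((r, C) # l) \<in> ext I C"
proof -
  have "\<exists>y. (reach I x l, y) \<in> rint I r \<and> y \<in> ext I C" using assms by simp
  from someI_ex[OF this] show ?thesis using assms by simp
qed

lemma reach_in_domain:
  assumes "interpretation_wf I" "x \<in> domain I"
  shows "reach I x l \<in> domain I"
proof (induction l)
  case Nil
  then show ?case using assms by simp
next
  case (Cons p l)
  show ?case
  proof (cases "reach I x l \<in> ext I (Exists (fst p) (snd p))")
    case True
    from reach_step[OF this] show ?thesis
      using ext_subset_domain[OF assms(1)] by (metis prod.collapse subsetD)
  next
    case False
    then show ?thesis using Cons by (simp del: ext.simps)
  qed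
qed

lemma countable_submodel:
  fixes I :: "'d interp"
  assumes wf: "interpretation_wf I" and x: "x \<in> domain I"
  obtains J :: "nat interp" and f and S where "interpretation_wf J" "x \<in> S" "inj_on f S"
    "\<And>C. ext J C = f ` (ext I C \<inter> S)"
    "\<And>r. rint J r = (\<lambda>(a, b). (f a, f b)) ` (rint I r \<inter> S \<times> S)"
proof -
  define S where "S = range (reach I x)"
  define f where "f = to_nat_on S"
  define J where "J = \<lparr>domain = f ` S, cint = (\<lambda>A. f ` (cint I A \<inter> S)),
    rint = (\<lambda>r. (\<lambda>(a, b). (f a, f b)) ` (rint I r \<inter> S \<times> S))\<rparr>"
  have inj: "inj_on f S" unfolding f_def S_def by (intro inj_on_to_nat_on) auto
  have xS: "x \<in> S" unfolding S_def by (metis reach.simps(1) rangeI)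
  have sub: "S \<subseteq> domain I" using reach_in_domain[OF wf x] by (auto simp: S_def)
  have wit: "\<exists>z\<in>S. (y, z) \<in> rint I r \<and> z \<in> ext I C" if "y \<in> S" "y \<in> ext I (Exists r C)" for y r C
  proof -
    from that(1) obtain l where "y = reach I x l" by (auto simp: S_def)
    with reach_step[of I x l r C] that(2) show ?thesis unfolding S_def by blast
  qed
  have "interpretation_wf J" using xS by (auto simp: interpretation_wf_def J_def)
  moreover have "ext J C = f ` (ext I C \<inter> S)" for C
  proof (induction C)
    case Top
    show ?case using sub by (auto simp: J_def)
  next
    case (Name A)
    show ?case by (simp add: J_def)
  next
    case (Neg C)
    have "f ` S - f ` (ext I C \<inter> S) = f ` ((domain I - ext I C) \<inter> S)"
      using inj sub by (auto simp: inj_on_def)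
    then show ?case using Neg by (simp add: J_def)
  next
    case (Conj C D)
    have "f ` (ext I C \<inter> S) \<inter> f ` (ext I D \<inter> S) = f ` ((ext I C \<inter> S) \<inter> (ext I D \<inter> S))"
      by (rule inj_on_image_Int[OF inj, symmetric]) auto
    also have "(ext I C \<inter> S) \<inter> (ext I D \<inter> S) = (ext I C \<inter> ext I D) \<inter> S" by blast
    finally show ?case using Conj by simp
  next
    case (Exists r C)
    show ?case
    proof (intro equalityI subsetI)
      fix u assume "u \<in> ext J (Exists r C)"
      then obtain v where "(u, v) \<in> rint J r" "v \<in> ext J C" by auto
      then obtain a b c where abc: "u = f a" "v = f b" "(a, b) \<in> rint I r" "a \<in> S" "b \<in> S"
        "v = f c" "c \<in> S" "c \<in> ext I C"
        using Exists.IH by (auto simp: J_def)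
      have "f b = f c" using abc by simp
      then have "b = c" using inj abc by (auto dest: inj_onD)
      then have "a \<in> ext I (Exists r C) \<inter> S" using sub abc by auto
      then show "u \<in> f ` (ext I (Exists r C) \<inter> S)" using abc by blast
    next
      fix u assume "u \<in> f ` (ext I (Exists r C) \<inter> S)"
      then obtain a where a: "u = f a" "a \<in> S" "a \<in> ext I (Exists r C)" by auto
      from wit[OF a(2,3)] obtain b where b: "b \<in> S" "(a, b) \<in> rint I r" "b \<in> ext I C" by auto
      have "(f a, f b) \<in> rint J r" using a b by (auto simp: J_def intro!: image_eqI[where x = "(a, b)"])
      moreover have "f b \<in> ext J C" using b Exists.IH by auto
      moreover have "u \<in> domain J" using a by (simp add: J_def)
      ultimately show "u \<in> ext J (Exists r C)" using a by auto
    qed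
  qed
  moreover have "rint J r = (\<lambda>(a, b). (f a, f b)) ` (rint I r \<inter> S \<times> S)" for r by (simp add: J_def)
  ultimately show thesis using that[of J S f] xS inj by blast
qed

theorem entails_all_models:
  fixes I :: "'d interp"
  assumes ent: "entails \<O> C D" and mod: "is_model I \<O>"
  shows "ext I C \<subseteq> ext I D"
proof
  fix x assume xC: "x \<in> ext I C"
  have wf: "interpretation_wf I" using mod by (simp add: is_model_def)
  have "x \<in> domain I" using xC ext_subset_domain[OF wf] by blast
  obtain J :: "nat interp" and f and S where
    J: "interpretation_wf J" and xS: "x \<in> S" and inj: "inj_on f S"
    and extJ: "\<And>C. ext J C = f ` (ext I C \<inter> S)"
    and rintJ: "\<And>r. rint J r = (\<lambda>(a, b). (f a, f b)) ` (rint I r \<inter> S \<times> S)"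
    by (rule countable_submodel[OF wf \<open>x \<in> domain I\<close>]) blast
  have "satisfies J a" if "a \<in> \<O>" for a
  proof -
    have "satisfies I a" using mod that by (simp add: is_model_def)
    show ?thesis
    proof (cases a)
      case (ConceptIncl E F)
      with \<open>satisfies I a\<close> have "ext I E \<inter> S \<subseteq> ext I F \<inter> S" by auto
      then show ?thesis using ConceptIncl by (simp add: extJ image_mono)
    next
      case (RoleIncl r s)
      with \<open>satisfies I a\<close> have "rint I r \<inter> S \<times> S \<subseteq> rint I s \<inter> S \<times> S" by auto
      then show ?thesis using RoleIncl by (simp add: rintJ image_mono)
    qed
  qed
  then have "is_model J \<O>" using J by (simp add: is_model_def)
  then have "ext J C \<subseteq> ext J D" using ent by (simp add: entails_def)
  moreover have "f x \<in> ext J C" unfolding extJ using xC xS by blast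
  ultimately have "f x \<in> f ` (ext I D \<inter> S)" unfolding extJ by blast
  then obtain y where "f x = f y" "y \<in> ext I D" "y \<in> S" by blast
  with inj xS show "x \<in> ext I D" by (metis inj_onD)
qed

end

theory Submission imports Defs begin

text \<open>Take \<open>\<O> = {r \<sqsubseteq> s\<^sub>1, r \<sqsubseteq> s\<^sub>2}\<close> and \<open>C\<^sub>0 = \<exists>r.\<top>\<close> with \<open>r\<close> hidden, where
  \<open>s\<^sub>1, s\<^sub>2, r\<close> are the role names 0, 1, 2. For every \<open>X\<close>, the concept \<open>\<forall>s\<^sub>1.X \<rightarrow> \<exists>s\<^sub>2.X\<close> follows
  from \<open>C\<^sub>0\<close>. There are \<open>Tower (n - 1)\<close> points that are pairwise separated by concepts of depth
  \<open>n - 1\<close>, namely the hereditarily finite sets of rank at most \<open>n - 1\<close>. If two of them,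
  \<open>a \<noteq> b\<close>, agree on all fillers of the outermost existential restrictions of \<open>U\<close>, then \<open>U\<close> cannot
  distinguish a root whose \<open>s\<^sub>1\<close>- and \<open>s\<^sub>2\<close>-successor is \<open>a\<close>, which satisfies \<open>C\<^sub>0\<close> once an
  \<open>r\<close>-edge is added, from a root with \<open>s\<^sub>1\<close>-successor \<open>a\<close> and \<open>s\<^sub>2\<close>-successor \<open>b\<close>, which violates
  such a consequence of depth \<open>n\<close>. So an interpolant has at least
  \<open>log\<^sub>2 (Tower (n - 1)) = Tower (n - 2)\<close> fillers.\<close>

text \<open>Numbers represent hereditarily finite sets by Ackermann's coding: \<open>k\<close> is an element of \<open>m\<close>
  iff bit \<open>k\<close> of \<open>m\<close> is set, so the sets of rank at most \<open>d\<close> are the numbers below \<open>Tower d\<close>. The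
  root is \<open>None\<close>.\<close>

definition two_succ_interp :: "nat \<Rightarrow> nat \<Rightarrow> nat option interp" where
  "two_succ_interp a b = \<lparr>domain = UNIV, cint = (\<lambda>_. {}),
     rint = (\<lambda>r. if r = 0 then insert (None, Some a) {(Some m, Some k) | m k. bit m k}
       else if r = 1 then {(None, Some b)}
       else if r = 2 then {(None, Some a)} \<inter> {(None, Some b)}
       else {})\<rparr>"

abbreviation hf_models :: "nat \<Rightarrow> alc \<Rightarrow> bool" where
  "hf_models m C \<equiv> Some m \<in> ext (two_succ_interp 0 0) C"

text \<open>Role 2 is interpreted by an intersection that is empty unless \<open>a = b\<close>, so
  both inclusions hold for all \<open>a\<close> and \<open>b\<close>.\<close>

lemma is_model_two_succ_interp:
  "is_model (two_succ_interp a b) {RoleIncl 2 0, RoleIncl 2 1}"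
  by (auto simp: is_model_def interpretation_wf_def two_succ_interp_def)

text \<open>No edge leads back to the root, and \<open>a\<close> and \<open>b\<close> only affect
  edges leaving it.\<close>

lemma Some_in_ext_two_succ_interp:
  "Some m \<in> ext (two_succ_interp a b) C \<longleftrightarrow> hf_models m C"
proof (induction C arbitrary: m)
  case (Exists r C)
  then show ?case by (auto simp: two_succ_interp_def)
qed (auto simp: two_succ_interp_def)

lemma hf_models_Exists_0: "hf_models m (Exists 0 C) \<longleftrightarrow> (\<exists>k. bit m k \<and> hf_models k C)"
  by (auto simp: two_succ_interp_def)

lemma None_in_ext_Exists:
  "None \<in> ext (two_succ_interp a b) (Exists 0 C) \<longleftrightarrow> hf_models a C"
  "None \<in> ext (two_succ_interp a b) (Exists 1 C) \<longleftrightarrow> hf_models b C"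
  using Some_in_ext_two_succ_interp[of _ a b C] by (auto simp: two_succ_interp_def)

lemma domain_two_succ_interp [simp]: "domain (two_succ_interp a b) = UNIV"
  by (simp add: two_succ_interp_def)

lemma finite_conjunction:
  fixes I :: "'d interp"
  assumes "finite S" and "\<And>C. C \<in> S \<Longrightarrow> sig C \<subseteq> \<Sigma> \<and> role_depth C \<le> d"
  obtains D where "sig D \<subseteq> \<Sigma>" "role_depth D \<le> d"
    "\<And>x. x \<in> ext I D \<longleftrightarrow> x \<in> domain I \<and> (\<forall>C\<in>S. x \<in> ext I C)"
proof -
  have "\<exists>D. sig D \<subseteq> \<Sigma> \<and> role_depth D \<le> d \<and>
      (\<forall>x. x \<in> ext I D \<longleftrightarrow> x \<in> domain I \<and> (\<forall>C\<in>S. x \<in> ext I C))"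
    using assms
  proof (induction S)
    case empty
    show ?case by (rule exI[of _ Top]) simp
  next
    case (insert C S)
    then obtain D where "sig D \<subseteq> \<Sigma>" "role_depth D \<le> d"
      "\<forall>x. x \<in> ext I D \<longleftrightarrow> x \<in> domain I \<and> (\<forall>C\<in>S. x \<in> ext I C)" by blast
    with insert.prems[of C] show ?case by (intro exI[of _ "Conj C D"]) auto
  qed
  then show thesis using that by blast
qed

lemma bit_less_exponent:
  fixes m :: nat
  assumes "m < 2 ^ N" "bit m k"
  shows "k < N"
proof (rule ccontr)
  assume "\<not> k < N"
  then have "(2::nat) ^ N \<le> 2 ^ k" by simp
  with assms(1) have "m < 2 ^ k" by linarith
  then have "m div 2 ^ k = 0" by simp
  with assms(2) show False by (simp add: bit_iff_odd)
qed

lemma hf_separated: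
  assumes "a < Tower d" "b < Tower d" "a \<noteq> b"
  shows "\<exists>X. sig X \<subseteq> {Inr 0} \<and> role_depth X \<le> d \<and> hf_models a X \<and> \<not> hf_models b X"
  using assms
proof (induction d arbitrary: a b)
  case 0
  then show ?case by simp
next
  case (Suc d)
  \<comment> \<open>A member \<open>k\<close> of \<open>p\<close> outside \<open>q\<close> differs
    from every member of \<open>q\<close>; conjoining separators of \<open>k\<close> from these
    finitely many members gives the filler \<open>D\<close>.\<close>
  have sep: "\<exists>X. sig X \<subseteq> {Inr 0} \<and> role_depth X \<le> Suc d \<and> hf_models p X \<and> \<not> hf_models q X"
    if pq: "p < Tower (Suc d)" "q < Tower (Suc d)" and k: "bit p k" "\<not> bit q k" for p q k
  proof -
    have "k < Tower d" using bit_less_exponent[of p "Tower d" k] pq k by simp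
    have "\<forall>j\<in>{j. bit q j}. \<exists>X. sig X \<subseteq> {Inr 0} \<and> role_depth X \<le> d \<and>
        hf_models k X \<and> \<not> hf_models j X"
    proof
      fix j assume "j \<in> {j. bit q j}"
      then have "j < Tower d" "k \<noteq> j" using bit_less_exponent[of q "Tower d" j] pq k by auto
      then show "\<exists>X. sig X \<subseteq> {Inr 0} \<and> role_depth X \<le> d \<and> hf_models k X \<and> \<not> hf_models j X"
        using Suc.IH \<open>k < Tower d\<close> by blast
    qed
    then obtain X where X: "\<And>j. bit q j \<Longrightarrow> sig (X j) \<subseteq> {Inr 0} \<and> role_depth (X j) \<le> d \<and>
        hf_models k (X j) \<and> \<not> hf_models j (X j)"
      by (metis mem_Collect_eq)
    have "{j. bit q j} \<subseteq> {..<Tower d}" using bit_less_exponent[of q "Tower d"] pq by auto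
    then have "finite (X ` {j. bit q j})" by (simp add: finite_subset)
    then obtain D where D: "sig D \<subseteq> {Inr 0}" "role_depth D \<le> d"
      "\<And>x. x \<in> ext (two_succ_interp 0 0) D \<longleftrightarrow>
         x \<in> domain (two_succ_interp 0 0) \<and>
         (\<forall>C\<in>X ` {j. bit q j}. x \<in> ext (two_succ_interp 0 0) C)"
      by (rule finite_conjunction[where I = "two_succ_interp 0 0" and \<Sigma> = "{Inr 0}" and d = d])
        (use X in auto)
    have "hf_models k D" using X D(3) by auto
    moreover have "\<not> hf_models j D" if "bit q j" for j using X[OF that] D(3) that by auto
    ultimately have "hf_models p (Exists 0 D)" "\<not> hf_models q (Exists 0 D)"
      using k(1) unfolding hf_models_Exists_0 by blast+
    then show ?thesis using D(1,2) by (intro exI[of _ "Exists 0 D"]) (simp del: ext.simps)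
  qed
  obtain k where "bit a k \<noteq> bit b k" using \<open>a \<noteq> b\<close> by (metis bit_eqI)
  then consider "bit a k" "\<not> bit b k" | "bit b k" "\<not> bit a k" by blast
  then show ?case
  proof cases
    case 1
    then show ?thesis using sep Suc.prems by blast
  next
    case 2
    then obtain X where "sig X \<subseteq> {Inr 0}" "role_depth X \<le> Suc d" "hf_models b X" "\<not> hf_models a X"
      using sep Suc.prems by blast
    then show ?thesis by (intro exI[of _ "Neg X"]) simp
  qed
qed

primrec fillers :: "alc \<Rightarrow> alc set" where
  "fillers Top = {}"
| "fillers (Name A) = {}"
| "fillers (Neg C) = fillers C"
| "fillers (Conj C D) = fillers C \<union> fillers D"
| "fillers (Exists r C) = {C}"

lemma finite_fillers [simp]: "finite (fillers C)"
  by (induction C) auto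

lemma card_fillers_le: "card (fillers C) \<le> concept_size C"
proof (induction C)
  case (Conj C D)
  have "card (fillers (Conj C D)) \<le> card (fillers C) + card (fillers D)"
    by (simp add: card_Un_le)
  with Conj show ?case by simp
qed auto

text \<open>At the root, \<open>U\<close> is a Boolean combination of existential restrictions, and
  only those over role 1 see the change from \<open>a\<close> to \<open>b\<close>.\<close>

lemma root_indistinguishable:
  assumes "sig U \<subseteq> {Inr 0, Inr 1}"
    and "\<And>D. D \<in> fillers U \<Longrightarrow> hf_models a D \<longleftrightarrow> hf_models b D"
  shows "None \<in> ext (two_succ_interp a a) U \<longleftrightarrow> None \<in> ext (two_succ_interp a b) U"
  using assms
proof (induction U)
  case (Name A)
  show ?case by (simp add: two_succ_interp_def)
next
  case (Exists r C)
  then have "r = 0 \<or> r = 1" by auto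
  then show ?case
    using Exists.prems(2)[of C] None_in_ext_Exists[of a a C] None_in_ext_Exists[of a b C]
    by (auto simp del: ext.simps)
qed auto

lemma entails_shared_successor:
  "entails {RoleIncl 2 0, RoleIncl 2 1} (Exists 2 Top)
     (Neg (Conj (Neg (Exists 0 (Neg X))) (Neg (Exists 1 X))))"
  by (fastforce simp: entails_def is_model_def interpretation_wf_def)

lemma uniform_interpolant_size:
  assumes "uniform_interpolant {Inr 0, Inr 1} (Suc (Suc d)) {RoleIncl 2 0, RoleIncl 2 1}
    (Exists 2 Top) U"
  shows "Tower d \<le> concept_size U"
proof (rule ccontr)
  let ?O = "{RoleIncl 2 0, RoleIncl 2 1}"
  let ?profile = "\<lambda>m. {D \<in> fillers U. hf_models m D}"
  assume "\<not> Tower d \<le> concept_size U"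
  \<comment> \<open>At most \<open>2 ^ concept_size U\<close> profiles exist, fewer than
    \<open>2 ^ Tower d = Tower (Suc d)\<close>.\<close>
  with card_fillers_le[of U] have "card (Pow (fillers U)) < card {..<Tower (Suc d)}"
    by (simp add: card_Pow)
  moreover have "card (?profile ` {..<Tower (Suc d)}) \<le> card (Pow (fillers U))"
    by (rule card_mono) auto
  ultimately have "\<not> inj_on ?profile {..<Tower (Suc d)}"
    by (intro pigeonhole) linarith
  then obtain a b where ab: "a < Tower (Suc d)" "b < Tower (Suc d)" "a \<noteq> b"
    "?profile a = ?profile b"
    unfolding inj_on_def by blast
  from hf_separated[OF ab(1-3)] obtain X where
    X: "sig X \<subseteq> {Inr 0}" "role_depth X \<le> Suc d" "hf_models a X" "\<not> hf_models b X" by blast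
  let ?E = "Neg (Conj (Neg (Exists 0 (Neg X))) (Neg (Exists 1 X)))"
  from assms have U: "sig U \<subseteq> {Inr 0, Inr 1}" "entails ?O (Exists 2 Top) U"
    and min: "\<And>E. sig E \<subseteq> {Inr 0, Inr 1} \<Longrightarrow> role_depth E \<le> Suc (Suc d) \<Longrightarrow>
      entails ?O (Exists 2 Top) E \<Longrightarrow> entails ?O U E"
    by (auto simp: uniform_interpolant_def)
  have "None \<in> ext (two_succ_interp a a) (Exists 2 Top)"
    by (simp add: two_succ_interp_def)
  then have "None \<in> ext (two_succ_interp a a) U"
    using entails_all_models[OF U(2) is_model_two_succ_interp] by blast
  then have "None \<in> ext (two_succ_interp a b) U"
    using root_indistinguishable[OF U(1)] ab(4) by blast
  moreover have "entails ?O U ?E"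
    by (rule min[OF _ _ entails_shared_successor]) (use X in auto)
  ultimately have "None \<in> ext (two_succ_interp a b) ?E"
    using entails_all_models[OF _ is_model_two_succ_interp] by blast
  then have "hf_models a (Neg X) \<or> hf_models b X"
    using None_in_ext_Exists[of a b] by (auto simp del: ext.simps(5))
  with X show False by simp
qed

theorem theorem1:
  "\<exists>(\<O> :: axm set) (C\<^sub>0 :: alc) (\<Sigma> :: signature). finite \<O> \<and>
     (\<forall>n :: nat. \<not> (\<exists>U. uniform_interpolant \<Sigma> n \<O> C\<^sub>0 U \<and> concept_size U < Tower (n - 2)))"
proof (intro exI conjI allI notI)
  show "finite {RoleIncl 2 0, RoleIncl 2 1}" by simp
next
  fix n
  assume "\<exists>U. uniform_interpolant {Inr 0, Inr 1} n {RoleIncl 2 0, RoleIncl 2 1} (Exists 2 Top) U \<and>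
    concept_size U < Tower (n - 2)"
  then obtain U where
    U: "uniform_interpolant {Inr 0, Inr 1} n {RoleIncl 2 0, RoleIncl 2 1} (Exists 2 Top) U"
    and size: "concept_size U < Tower (n - 2)" by blast
  show False
  proof (cases "n < 2")
    \<comment> \<open>Truncated subtraction makes the bound \<open>Tower 0 = 1\<close>, and every
      concept has at least one symbol.\<close>
    case True
    then have "n - 2 = 0" by simp
    moreover have "concept_size U > 0" by (cases U) auto
    ultimately show False using size by simp
  next
    case False
    then have "n = Suc (Suc (n - 2))" by simp
    then show False using uniform_interpolant_size U size by (metis not_less)
  qed
qed

end
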